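(* Let $k,n,s, \alpha \in \mathbb{N}$, let $p$ be a prime, and let $\mathbf{A}=(A;+,-,0,(f_i)_{i\in S})$ be a $k$-supernilpotent expanded elementary abelian group of order $p^{\alpha}$. Let $F = (f_1, \ldots, f_s) \in \mathrm{Pol}_{n,s} (\mathbf{A})$, and let $\mathbf{a} \in A^n$. Then there is $U \subseteq \{1,\ldots,n\}$ with $|U| \le k s \alpha (p-1)$ such that $F (\mathbf{a}) = F (\mathbf{a}|_{U})$.
   Context: An expanded elementary abelian group is an algebra $(A;+,-,0,(f_i)_{i\in S})$ whose reduct $(A;+,-,0)$ is an elementary abelian group (abelian, all nonzero elements of the same prime order). $\mathrm{Pol}_n(\mathbf{A})$ is the set of $n$-ary polynomial functions of $\mathbf{A}$ (term functions of the expansion of $\mathbf{A}$ by all constants), and $\mathrm{Pol}_{n,s}(\mathbf{A})$ is the set of maps $A^n\to A^s$, $\mathbf{a}\mapsto(f_1(\mathbf{a}),\ldots,f_s(\mathbf{a}))$ with $f_1,\ldots,f_s\in\mathrm{Pol}_n(\mathbf{A})$. For $\mathbf{a}\in A^n$ and $U\subseteq\{1,\ldots,n\}$, $\mathbf{a}|_U(j)=\mathbf{a}(j)$ for $j\in U$ and $\mathbf{a}|_U(j)=0$ otherwise. Higher commutators: for congruences $\alpha_1,\ldots,\alpha_r,\beta$ of an algebra ($r\ge 2$), $C(\alpha_1,\ldots,\alpha_r;\beta)$ holds if for every term function $t$ and all tuples $\mathbf{a}_i\,\alpha_i\,\mathbf{b}_i$ (componentwise): if $t(\mathbf{x}_1,\ldots,\mathbf{x}_{r-1},\mathbf{a}_r)\,\beta\,t(\mathbf{x}_1,\ldots,\mathbf{x}_{r-1},\mathbf{b}_r)$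 for all $(\mathbf{x}_1,\ldots,\mathbf{x}_{r-1})\in\prod_{i<r}\{\mathbf{a}_i,\mathbf{b}_i\}$ other than $(\mathbf{b}_1,\ldots,\mathbf{b}_{r-1})$, then $t(\mathbf{b}_1,\ldots,\mathbf{b}_{r-1},\mathbf{a}_r)\,\beta\,t(\mathbf{b}_1,\ldots,\mathbf{b}_{r-1},\mathbf{b}_r)$. $[\alpha_1,\ldots,\alpha_r]$ is the least such $\beta$. An algebra is $k$-supernilpotent if $[1_A,\ldots,1_A]$ ($k+1$ entries) is the identity congruence. *)

theory Defs
  imports "HOL-Algebra.Multiplicative_Group" "HOL-Computational_Algebra.Primes"
begin

section \<open>Algebras, terms and polynomial functions\<close>

definition tuples :: "'a set \<Rightarrow> nat \<Rightarrow> 'a list set" where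
  "tuples A n = {xs. length xs = n \<and> set xs \<subseteq> A}"

text \<open>
  \<open>fsyms\<close> is the set of basic operation symbols; \<open>interp g\<close> is only meaningful for
  \<open>g \<in> fsyms\<close>, on tuples of length \<open>arity g\<close> over the carrier.
\<close>

record ('a, 'f) ualg = "'a partial_object" +
  fsyms :: "'f set"
  arity :: "'f \<Rightarrow> nat"
  interp :: "'f \<Rightarrow> 'a list \<Rightarrow> 'a"

definition is_ualg :: "('a, 'f) ualg \<Rightarrow> bool" where
  "is_ualg A \<longleftrightarrow> (\<forall>g\<in>fsyms A. interp A g \<in> tuples (carrier A) (arity A g) \<rightarrow> carrier A)"

datatype 'f uterm = Var nat | App 'f "'f uterm list"

text \<open>\<open>is_term A n t\<close>: \<open>t\<close> is a term of \<open>A\<close> in the \<open>n\<close> variables \<open>Var 0, \<dots>, Var (n - 1)\<close>.\<close>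

fun is_term :: "('a, 'f) ualg \<Rightarrow> nat \<Rightarrow> 'f uterm \<Rightarrow> bool" where
  "is_term A n (Var i) \<longleftrightarrow> i < n"
| "is_term A n (App g ts) \<longleftrightarrow>
     g \<in> fsyms A \<and> length ts = arity A g \<and> (\<forall>t\<in>set ts. is_term A n t)"

fun term_eval :: "('a, 'f) ualg \<Rightarrow> 'a list \<Rightarrow> 'f uterm \<Rightarrow> 'a" where
  "term_eval A xs (Var i) = xs ! i"
| "term_eval A xs (App g ts) = interp A g (map (term_eval A xs) ts)"

definition term_funs :: "('a, 'f) ualg \<Rightarrow> nat \<Rightarrow> ('a list \<Rightarrow> 'a) set" where
  "term_funs A n = {\<lambda>xs\<in>tuples (carrier A) n. term_eval A xs t | t. is_term A n t}"

definition const_expansion :: "('a, 'f) ualg \<Rightarrow> ('a, 'f + 'a) ualg" where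
  "const_expansion A = \<lparr>carrier = carrier A,
     fsyms = fsyms A <+> carrier A,
     arity = case_sum (arity A) (\<lambda>c. 0),
     interp = case_sum (interp A) (\<lambda>c xs. c)\<rparr>"

definition Pol :: "('a, 'f) ualg \<Rightarrow> nat \<Rightarrow> ('a list \<Rightarrow> 'a) set" where
  "Pol A n = term_funs (const_expansion A) n"

definition Pol_vec :: "('a, 'f) ualg \<Rightarrow> nat \<Rightarrow> nat \<Rightarrow> ('a list \<Rightarrow> 'a list) set" where
  "Pol_vec A n s = {\<lambda>xs\<in>tuples (carrier A) n. map (\<lambda>f. f xs) fs | fs. fs \<in> tuples (Pol A n) s}"


section \<open>Congruences and higher commutators\<close>

definition congruence :: "('a, 'f) ualg \<Rightarrow> ('a \<times> 'a) set \<Rightarrow> bool" where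
  "congruence A \<theta> \<longleftrightarrow> equiv (carrier A) \<theta> \<and>
     (\<forall>g\<in>fsyms A. \<forall>xs\<in>tuples (carrier A) (arity A g). \<forall>ys\<in>tuples (carrier A) (arity A g).
        list_all2 (\<lambda>x y. (x, y) \<in> \<theta>) xs ys \<longrightarrow> (interp A g xs, interp A g ys) \<in> \<theta>)"

definition select_tuples :: "nat set \<Rightarrow> 'b list \<Rightarrow> 'b list \<Rightarrow> 'b list" where
  "select_tuples J as bs = map (\<lambda>i. if i \<in> J then bs ! i else as ! i) [0..<length as]"

text \<open>
  The list \<open>\<alpha>s\<close> holds all arguments \<open>\<alpha>\<^sub>1, \<dots>, \<alpha>\<^bsub>r-1\<^esub>\<close> but the last one, which is \<open>\<gamma> = \<alpha>\<^sub>r\<close>;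
  likewise \<open>a\<close>, \<open>b\<close> are the last tuples, and the term function takes the concatenation of the
  \<open>r\<close> tuples as its argument. A vector \<open>(x\<^sub>1, \<dots>, x\<^bsub>r-1\<^esub>)\<close> with \<open>x\<^sub>i\<close> chosen from
  \<open>a\<^sub>i\<close>, \<open>b\<^sub>i\<close> is described by the set \<open>J\<close> of those \<open>i\<close> where \<open>b\<^sub>i\<close> is chosen; the choice excluded
  from the premise is the one that picks every \<open>b\<^sub>i\<close>. Choices, not the resulting vectors, are
  distinguished: if \<open>a\<^sub>i = b\<^sub>i\<close> for some \<open>i\<close> then a proper subset \<open>J\<close> may also give
  \<open>(b\<^sub>1, \<dots>, b\<^bsub>r-1\<^esub>)\<close>. (Excluding the vector itself would drop this instance of the premise, and
  with \<open>a\<^sub>1 = b\<^sub>1\<close> the condition for \<open>r = 2\<close> would force \<open>\<alpha>\<^sub>2 \<subseteq> \<beta>\<close>.)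
\<close>

definition centralizes ::
  "('a, 'f) ualg \<Rightarrow> ('a \<times> 'a) set list \<Rightarrow> ('a \<times> 'a) set \<Rightarrow> ('a \<times> 'a) set \<Rightarrow> bool" where
  "centralizes A \<alpha>s \<gamma> \<beta> \<longleftrightarrow>
     (\<forall>as bs a b. \<forall>t\<in>term_funs A (length (concat as) + length a).
        length as = length \<alpha>s \<longrightarrow> length bs = length \<alpha>s \<longrightarrow>
        (\<forall>i<length \<alpha>s. list_all2 (\<lambda>x y. (x, y) \<in> \<alpha>s ! i) (as ! i) (bs ! i)) \<longrightarrow>
        list_all2 (\<lambda>x y. (x, y) \<in> \<gamma>) a b \<longrightarrow>
        (\<forall>J. J \<subset> {..<length \<alpha>s} \<longrightarrow>
           (t (concat (select_tuples J as bs) @ a), t (concat (select_tuples J as bs) @ b)) \<in> \<beta>) \<longrightarrow>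
        (t (concat bs @ a), t (concat bs @ b)) \<in> \<beta>)"

definition commutator ::
  "('a, 'f) ualg \<Rightarrow> ('a \<times> 'a) set list \<Rightarrow> ('a \<times> 'a) set \<Rightarrow> ('a \<times> 'a) set" where
  "commutator A \<alpha>s \<gamma> = \<Inter>{\<beta>. congruence A \<beta> \<and> centralizes A \<alpha>s \<gamma> \<beta>}"

definition supernilpotent :: "nat \<Rightarrow> ('a, 'f) ualg \<Rightarrow> bool" where
  "supernilpotent k A \<longleftrightarrow>
     commutator A (replicate k (carrier A \<times> carrier A)) (carrier A \<times> carrier A) = Id_on (carrier A)"


text \<open>The intersection defining the commutator is the least congruence in question.\<close>

lemma term_eval_closed:
  assumes "is_ualg A" "xs \<in> tuples (carrier A) n" "is_term A n t"
  shows "term_eval A xs t \<in> carrier A"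
  using assms(3)
proof (induction t)
  case (Var i)
  then show ?case using assms(2) by (auto simp: tuples_def)
next
  case (App g ts)
  then have "map (term_eval A xs) ts \<in> tuples (carrier A) (arity A g)"
    by (auto simp: tuples_def)
  then show ?case using assms(1) App.prems by (auto simp: is_ualg_def Pi_iff)
qed

lemma term_fun_closed:
  assumes "is_ualg A" "xs \<in> tuples (carrier A) n" "t \<in> term_funs A n"
  shows "t xs \<in> carrier A"
  using assms(2,3) term_eval_closed[OF assms(1,2)] by (auto simp: term_funs_def)

lemma congruence_full:
  assumes "is_ualg A"
  shows "congruence A (carrier A \<times> carrier A)"
  using assms unfolding congruence_def is_ualg_def
  by (auto intro!: equivI simp: refl_on_def sym_def trans_def Pi_iff)

lemma list_all2_tuples:
  assumes "list_all2 (\<lambda>x y. (x, y) \<in> \<theta>) xs ys" "\<theta> \<subseteq> A \<times> A"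
  shows "set xs \<subseteq> A" "set ys \<subseteq> A" "length xs = length ys"
  using assms by (fastforce simp: list_all2_conv_all_nth set_conv_nth)+

lemma centralizes_full:
  assumes "is_ualg A" "\<forall>\<alpha>\<in>set \<alpha>s. congruence A \<alpha>" "congruence A \<gamma>"
  shows "centralizes A \<alpha>s \<gamma> (carrier A \<times> carrier A)"
  unfolding centralizes_def
proof (intro allI ballI impI)
  fix as bs :: "'a list list" and a b t
  assume t: "t \<in> term_funs A (length (concat as) + length a)"
    and l: "length as = length \<alpha>s" "length bs = length \<alpha>s"
    and r: "\<forall>i<length \<alpha>s. list_all2 (\<lambda>x y. (x, y) \<in> \<alpha>s ! i) (as ! i) (bs ! i)"
    and ab: "list_all2 (\<lambda>x y. (x, y) \<in> \<gamma>) a b"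
  have sub: "\<gamma> \<subseteq> carrier A \<times> carrier A" "\<And>i. i < length \<alpha>s \<Longrightarrow> \<alpha>s ! i \<subseteq> carrier A \<times> carrier A"
    using assms(2,3) by (auto simp: congruence_def equiv_def)
  have "map length bs = map length as"
    using r l by (intro nth_equalityI) (auto simp: list_all2_lengthD)
  then have len: "length (concat bs) = length (concat as)"
    by (simp add: length_concat)
  have B: "set (concat bs) \<subseteq> carrier A"
  proof
    fix x assume "x \<in> set (concat bs)"
    then obtain c where "c \<in> set bs" "x \<in> set c"
      by auto
    then obtain i where i: "i < length \<alpha>s" "x \<in> set (bs ! i)"
      using l by (metis in_set_conv_nth)
    then show "x \<in> carrier A"
      using list_all2_tuples(2)[OF r[rule_format] sub(2)] by blast
  qed
  have "concat bs @ a \<in> tuples (carrier A) (length (concat as) + length a)"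
    "concat bs @ b \<in> tuples (carrier A) (length (concat as) + length a)"
    using B len list_all2_tuples[OF ab sub(1)] by (simp_all add: tuples_def)
  then show "(t (concat bs @ a), t (concat bs @ b)) \<in> carrier A \<times> carrier A"
    using term_fun_closed[OF assms(1) _ t] by blast
qed

lemma commutator_least:
  assumes "congruence A \<beta>" "centralizes A \<alpha>s \<gamma> \<beta>"
  shows "commutator A \<alpha>s \<gamma> \<subseteq> \<beta>"
  using assms unfolding commutator_def by blast

lemma centralizes_commutator: "centralizes A \<alpha>s \<gamma> (commutator A \<alpha>s \<gamma>)"
  unfolding commutator_def centralizes_def by blast

lemma congruence_commutator:
  assumes "is_ualg A" "\<forall>\<alpha>\<in>set \<alpha>s. congruence A \<alpha>" "congruence A \<gamma>"
  shows "congruence A (commutator A \<alpha>s \<gamma>)"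
proof -
  define \<C> where "\<C> = {\<beta>. congruence A \<beta> \<and> centralizes A \<alpha>s \<gamma> \<beta>}"
  have full: "carrier A \<times> carrier A \<in> \<C>"
    using congruence_full centralizes_full assms by (auto simp: \<C>_def)
  have cong: "congruence A \<beta>" if "\<beta> \<in> \<C>" for \<beta>
    using that by (simp add: \<C>_def)
  have "equiv (carrier A) (\<Inter>\<C>)"
  proof (rule equivI)
    show "\<Inter>\<C> \<subseteq> carrier A \<times> carrier A" using full by blast
    show "refl_on (carrier A) (\<Inter>\<C>)"
      using cong by (auto simp: congruence_def equiv_def refl_on_def)
    show "sym (\<Inter>\<C>)"
      using cong by (auto simp: congruence_def equiv_def sym_def)
    show "trans (\<Inter>\<C>)"
      using cong unfolding congruence_def equiv_def trans_def by blast
  qed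
  moreover have "(interp A g xs, interp A g ys) \<in> \<Inter>\<C>"
    if "g \<in> fsyms A" "xs \<in> tuples (carrier A) (arity A g)" "ys \<in> tuples (carrier A) (arity A g)"
      "list_all2 (\<lambda>x y. (x, y) \<in> \<Inter>\<C>) xs ys" for g xs ys
  proof (rule InterI)
    fix \<beta> assume \<beta>: "\<beta> \<in> \<C>"
    have "list_all2 (\<lambda>x y. (x, y) \<in> \<beta>) xs ys"
      using that(4) by (rule list_all2_mono) (use \<beta> in blast)
    then show "(interp A g xs, interp A g ys) \<in> \<beta>"
      using cong[OF \<beta>] that(1-3) unfolding congruence_def by blast
  qed
  ultimately show ?thesis
    unfolding commutator_def \<C>_def[symmetric] by (simp add: congruence_def)
qed


section \<open>Expanded elementary abelian groups\<close>

text \<open>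
  The group \<open>(A; +, -, 0)\<close> is a commutative group in the (multiplicative) notation of
  \<open>HOL-Algebra\<close>.
\<close>

definition elementary_abelian_group :: "('a, 'b) monoid_scheme \<Rightarrow> bool" where
  "elementary_abelian_group G \<longleftrightarrow> comm_group G \<and>
     (\<exists>q::nat. prime q \<and> (\<forall>x\<in>carrier G. x \<noteq> \<one>\<^bsub>G\<^esub> \<longrightarrow> group.ord G x = q))"

datatype 'i gsym = Plus | Minus | Zero | Extra 'i

definition expanded_group ::
  "('a, 'b) monoid_scheme \<Rightarrow> 'i set \<Rightarrow> ('i \<Rightarrow> nat) \<Rightarrow> ('i \<Rightarrow> 'a list \<Rightarrow> 'a) \<Rightarrow> ('a, 'i gsym) ualg" where
  "expanded_group G S ar f = \<lparr>carrier = carrier G,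
     fsyms = {Plus, Minus, Zero} \<union> Extra ` S,
     arity = (\<lambda>g. case g of Plus \<Rightarrow> 2 | Minus \<Rightarrow> 1 | Zero \<Rightarrow> 0 | Extra i \<Rightarrow> ar i),
     interp = (\<lambda>g xs. case g of
         Plus \<Rightarrow> xs ! 0 \<otimes>\<^bsub>G\<^esub> xs ! 1
       | Minus \<Rightarrow> inv\<^bsub>G\<^esub> (xs ! 0)
       | Zero \<Rightarrow> \<one>\<^bsub>G\<^esub>
       | Extra i \<Rightarrow> f i xs)\<rparr>"

definition expanded_elementary_abelian_group ::
  "('a, 'b) monoid_scheme \<Rightarrow> 'i set \<Rightarrow> ('i \<Rightarrow> nat) \<Rightarrow> ('i \<Rightarrow> 'a list \<Rightarrow> 'a) \<Rightarrow> bool" where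
  "expanded_elementary_abelian_group G S ar f \<longleftrightarrow> elementary_abelian_group G \<and>
     (\<forall>i\<in>S. f i \<in> tuples (carrier G) (ar i) \<rightarrow> carrier G)"

lemma is_ualg_expanded_group:
  assumes "expanded_elementary_abelian_group G S ar f"
  shows "is_ualg (expanded_group G S ar f)"
proof -
  interpret comm_group G
    using assms
    by (simp add: expanded_elementary_abelian_group_def elementary_abelian_group_def)
  have "\<forall>i\<in>S. f i \<in> tuples (carrier G) (ar i) \<rightarrow> carrier G"
    using assms by (simp add: expanded_elementary_abelian_group_def)
  moreover have "xs ! 0 \<otimes>\<^bsub>G\<^esub> xs ! 1 \<in> carrier G" if "xs \<in> tuples (carrier G) 2" for xs
    using that nth_mem[of 0 xs] nth_mem[of 1 xs] by (intro m_closed) (auto simp: tuples_def)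
  moreover have "inv\<^bsub>G\<^esub> (xs ! 0) \<in> carrier G" if "xs \<in> tuples (carrier G) 1" for xs
    using that nth_mem[of 0 xs] by (intro inv_closed) (auto simp: tuples_def)
  ultimately show ?thesis
    by (simp add: is_ualg_def expanded_group_def Pi_iff)
qed

text \<open>Coordinates of a tuple are numbered from 1, list positions from 0.\<close>

definition restrict_tuple :: "('a, 'b) monoid_scheme \<Rightarrow> 'a list \<Rightarrow> nat set \<Rightarrow> 'a list" where
  "restrict_tuple G a U = map (\<lambda>j. if j \<in> U then a ! (j - 1) else \<one>\<^bsub>G\<^esub>) [1..<Suc (length a)]"

end

theory Submission
  imports Defs "HOL-Number_Theory.Residues"
begin

text \<open>
  Supernilpotence makes the alternating product of the values \<open>f(\<^bold>a|\<^sub>J)\<close>, \<open>J \<subseteq> I\<close>, trivial for every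
  polynomial function \<open>f\<close> and every \<open>I\<close> with more than \<open>k\<close> elements. By Moebius inversion, each of
  the \<open>s\<alpha>\<close> coordinates of \<open>F(\<^bold>a|\<^sub>X)\<close> over the field with \<open>p\<close> elements is then a multilinear
  polynomial of degree at most \<open>k\<close> in the indicator vector of \<open>X\<close>. If \<open>X\<close> is minimal with
  \<open>F(\<^bold>a|\<^sub>X) = F(\<^bold>a)\<close>, then Fermat's little theorem turns these coordinates into a polynomial of degree
  at most \<open>ks\<alpha>(p - 1)\<close> that represents the indicator function of \<open>X\<close> on the power set of \<open>X\<close>. The
  multilinear representation of that function is unique and has degree \<open>|X|\<close>.
\<close>

section \<open>Integer-valued functions on the Boolean cube\<close>

text \<open>Multilinear polynomials without coefficients or variables:
  \<open>if I \<subseteq> X then c else 0\<close> is \<open>c\<close> times the product of the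
  0/1-variables indexed by \<open>I\<close>, evaluated at the indicator vector of \<open>X\<close>.
  The bound \<open>d\<close> is an upper bound on the degree, not the exact degree.\<close>

inductive bool_degree :: "nat \<Rightarrow> ('b set \<Rightarrow> int) \<Rightarrow> bool" where
  monomial: "finite I \<Longrightarrow> card I \<le> d \<Longrightarrow> bool_degree d (\<lambda>X. if I \<subseteq> X then c else 0)"
| add: "bool_degree d g \<Longrightarrow> bool_degree d h \<Longrightarrow> bool_degree d (\<lambda>X. g X + h X)"

lemma bool_degree_const: "bool_degree d (\<lambda>X. c)"
  using bool_degree.monomial[of "{}" d c] by simp

text \<open>Variables are idempotent on the cube, so the monomials of \<open>I\<close> and
  \<open>J\<close> multiply to that of \<open>I \<union> J\<close>.\<close>

lemma bool_degree_mult_monomial: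
  assumes "bool_degree e h" "finite I" "card I \<le> d"
  shows "bool_degree (d + e) (\<lambda>X. (if I \<subseteq> X then c else 0) * h X)"
  using assms
proof induction
  case (monomial J e c')
  have "bool_degree (d + e) (\<lambda>X. if I \<union> J \<subseteq> X then c * c' else 0)"
    using monomial card_Un_le[of I J] by (intro bool_degree.monomial) auto
  moreover have "(\<lambda>X. if I \<union> J \<subseteq> X then c * c' else 0) =
      (\<lambda>X. (if I \<subseteq> X then c else 0) * (if J \<subseteq> X then c' else 0))"
    by auto
  ultimately show ?case by metis
next
  case (add e g h)
  then show ?case by (auto simp: distrib_left intro: bool_degree.add)
qed

lemma bool_degree_mult:
  assumes "bool_degree d g" "bool_degree e h"
  shows "bool_degree (d + e) (\<lambda>X. g X * h X)"
  using assms
proof induction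
  case (monomial I d c)
  then show ?case using bool_degree_mult_monomial by blast
next
  case (add d g g')
  then show ?case by (auto simp: distrib_right intro: bool_degree.add)
qed

lemma bool_degree_uminus:
  assumes "bool_degree d g"
  shows "bool_degree d (\<lambda>X. - g X)"
  using bool_degree_mult[OF bool_degree_const[of 0 "-1"] assms] by simp

lemma bool_degree_diff:
  assumes "bool_degree d g" "bool_degree d h"
  shows "bool_degree d (\<lambda>X. g X - h X)"
  using bool_degree.add[OF assms(1) bool_degree_uminus[OF assms(2)]] by simp

lemma bool_degree_power:
  assumes "bool_degree d g"
  shows "bool_degree (m * d) (\<lambda>X. g X ^ m)"
  by (induction m) (auto intro: bool_degree_const bool_degree_mult assms)

lemma bool_degree_sum:
  assumes "finite K" "\<And>i. i \<in> K \<Longrightarrow> bool_degree d (g i)"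
  shows "bool_degree d (\<lambda>X. \<Sum>i\<in>K. g i X)"
  using assms by (induction K) (auto intro: bool_degree_const bool_degree.add)

lemma bool_degree_prod:
  assumes "finite K" "\<And>i. i \<in> K \<Longrightarrow> bool_degree d (g i)"
  shows "bool_degree (card K * d) (\<lambda>X. \<Prod>i\<in>K. g i X)"
  using assms by (induction K) (auto intro: bool_degree_const bool_degree_mult)

text \<open>A monomial with fewer variables than \<open>card U\<close> misses some \<open>u\<close>
  in \<open>U\<close>. Toggling \<open>u\<close> keeps its value and flips the sign, so the terms
  for \<open>X\<close> and \<open>insert u X\<close> cancel.\<close>

lemma alternating_sum_bool_degree_eq_0:
  assumes "bool_degree d g" "finite U" "d < card U"
  shows "(\<Sum>X\<in>Pow U. (- 1) ^ card X * g X) = 0"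
  using assms
proof induction
  case (monomial I d c)
  have "\<not> U \<subseteq> I" using monomial card_mono[of I U] by auto
  then obtain u where u: "u \<in> U" "u \<notin> I" by auto
  define V where "V = U - {u}"
  have V: "U = insert u V" "u \<notin> V" "finite V" using u monomial by (auto simp: V_def)
  define w where "w X = (- 1) ^ card X * (if I \<subseteq> X then c else 0)" for X
  have "(\<Sum>X\<in>Pow U. w X) = (\<Sum>X\<in>Pow V. w X) + (\<Sum>X\<in>insert u ` Pow V. w X)"
    unfolding V(1) Pow_insert using V by (intro sum.union_disjoint) auto
  also have "(\<Sum>X\<in>insert u ` Pow V. w X) = (\<Sum>X\<in>Pow V. w (insert u X))"
    using V by (intro sum.reindex_cong[of "insert u"] inj_onI) auto
  also have "\<dots> = (\<Sum>X\<in>Pow V. - w X)"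
  proof (rule sum.cong)
    fix X assume "X \<in> Pow V"
    then have "finite X" "u \<notin> X" using V finite_subset by auto
    then show "w (insert u X) = - w X"
      using u(2) by (auto simp: w_def)
  qed simp
  finally show ?case by (simp add: w_def sum_negf)
next
  case (add d g h)
  then show ?case by (simp add: distrib_left sum.distrib)
qed

text \<open>By Moebius inversion, \<open>(- 1) ^ card I * b I\<close> is the coefficient of the
  monomial of \<open>I\<close> in \<open>g\<close>. The coefficients with \<open>card I > k\<close>
  vanish modulo \<open>p\<close>, so truncating the expansion at degree \<open>k\<close> does not
  change \<open>g\<close> modulo \<open>p\<close>.\<close>

lemma bool_degree_cong_if_alternating_sums_dvd:
  fixes g :: "'b set \<Rightarrow> int"
  assumes "finite V"
    and dvd: "\<And>I. I \<subseteq> V \<Longrightarrow> k < card I \<Longrightarrow> p dvd (\<Sum>J\<in>Pow I. (- 1) ^ card J * g J)"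
  shows "\<exists>h. bool_degree k h \<and> (\<forall>X\<subseteq>V. [h X = g X] (mod p))"
proof -
  define b where "b I = (\<Sum>J\<in>Pow I. (- 1) ^ card J * g J)" for I
  define \<I> where "\<I> = {I \<in> Pow V. card I \<le> k}"
  define h where "h X = (\<Sum>I\<in>\<I>. if I \<subseteq> X then (- 1) ^ card I * b I else 0)" for X
  have fin: "finite \<I>" using assms(1) by (simp add: \<I>_def)
  have "bool_degree k h"
    unfolding h_def using assms(1)
    by (intro bool_degree_sum[OF fin] bool_degree.monomial) (auto simp: \<I>_def finite_subset)
  moreover have "[h X = g X] (mod p)" if X: "X \<subseteq> V" for X
  proof -
    have finX: "finite X" using X assms(1) finite_subset by blast
    have "h X = (\<Sum>I\<in>{I \<in> \<I>. I \<subseteq> X}. (- 1) ^ card I * b I)"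
      unfolding h_def using fin by (simp add: sum.inter_filter)
    also have "{I \<in> \<I>. I \<subseteq> X} = {I \<in> Pow X. card I \<le> k}"
      using X by (auto simp: \<I>_def)
    also have "(\<Sum>I\<in>\<dots>. (- 1) ^ card I * b I) =
        (\<Sum>I\<in>Pow X. if card I \<le> k then (- 1) ^ card I * b I else 0)"
      using finX by (simp add: sum.inter_filter[symmetric] Pow_def)
    also have "[\<dots> = (\<Sum>I\<in>Pow X. (- 1) ^ card I * b I)] (mod p)"
    proof (rule cong_sum)
      fix I assume "I \<in> Pow X"
      then have "k < card I \<Longrightarrow> p dvd b I" using dvd[of I] X by (auto simp: b_def)
      then show "[(if card I \<le> k then (- 1) ^ card I * b I else 0) = (- 1) ^ card I * b I] (mod p)"
        by (auto simp: cong_def)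
    qed
    also have "(\<Sum>I\<in>Pow X. (- 1) ^ card I * b I) = g X"
      by (rule inclusion_exclusion_symmetric[symmetric]) (auto simp: b_def finX)
    finally show ?thesis .
  qed
  ultimately show ?thesis by blast
qed

text \<open>
  The product of the \<open>1 - (h\<^sub>i(Y) - h\<^sub>i(X))\<^bsup>p-1\<^esup>\<close> has degree at most \<open>|K| k (p - 1)\<close>, and modulo
  \<open>p\<close> it is the indicator of \<open>Y = X\<close> on the subsets of \<open>X\<close>, whose alternating sum does not vanish.
\<close>

lemma card_le_if_bool_degree_separates:
  assumes p: "prime p" and "finite K" "finite X"
    and h: "\<And>i. i \<in> K \<Longrightarrow> bool_degree k (h i)"
    and sep: "\<And>Y. Y \<subset> X \<Longrightarrow> \<exists>i\<in>K. \<not> [h i Y = h i X] (mod int p)"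
  shows "card X \<le> k * card K * (p - 1)"
proof (rule ccontr)
  assume large: "\<not> ?thesis"
  define D where "D Y = (\<Prod>i\<in>K. 1 - (h i Y - h i X) ^ (p - 1))" for Y
  have "bool_degree (card K * ((p - 1) * k)) D"
    unfolding D_def
    by (intro bool_degree_prod assms bool_degree_diff bool_degree_power bool_degree_const)
  then have zero: "(\<Sum>Y\<in>Pow X. (- 1) ^ card Y * D Y) = 0"
    by (rule alternating_sum_bool_degree_eq_0) (use large assms in \<open>auto simp: mult_ac\<close>)
  have p1: "p - 1 > 0" using prime_gt_1_nat[OF p] by simp
  have DX: "D X = 1" using p1 by (simp add: D_def power_0_left)
  have dvd: "int p dvd D Y" if Y: "Y \<subset> X" for Y
  proof -
    obtain i where i: "i \<in> K" "\<not> [h i Y = h i X] (mod int p)" using sep[OF Y] by blast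
    define z where "z = h i Y - h i X"
    have "\<not> int p dvd z" using i(2) by (simp add: z_def cong_iff_dvd_diff)
    then have nz: "\<not> p dvd nat (z mod int p)"
      using prime_gt_0_nat[OF p]
      by (metis dvd_imp_mod_0 int_dvd_int_iff dvd_mod_iff dvd_refl int_nat_eq of_nat_0_less_iff pos_mod_sign)
    have "[int (nat (z mod int p)) ^ (p - 1) = 1] (mod int p)"
      using fermat_theorem[OF p nz] by (metis cong_int_iff of_nat_1 of_nat_power)
    moreover have "[int (nat (z mod int p)) ^ (p - 1) = z ^ (p - 1)] (mod int p)"
      using prime_gt_0_nat[OF p] by (intro cong_pow) (simp add: cong_def)
    ultimately have "[z ^ (p - 1) = 1] (mod int p)"
      by (metis cong_sym cong_trans)
    then have "int p dvd 1 - z ^ (p - 1)"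
      by (simp add: cong_iff_dvd_diff dvd_diff_commute)
    then show ?thesis
      unfolding D_def z_def using i(1) assms(2) dvd_trans
      by (metis (no_types, lifting) dvd_prodI)
  qed
  have "(\<Sum>Y\<in>Pow X. (- 1) ^ card Y * D Y) =
      (- 1) ^ card X * D X + (\<Sum>Y\<in>Pow X - {X}. (- 1) ^ card Y * D Y)"
    using assms(3) by (intro sum.remove) auto
  moreover have "int p dvd (\<Sum>Y\<in>Pow X - {X}. (- 1) ^ card Y * D Y)"
    using dvd by (intro dvd_sum dvd_mult) auto
  ultimately have "int p dvd (- 1) ^ card X"
    using zero DX by (metis add_diff_cancel_left' diff_0 dvd_minus_iff mult.right_neutral)
  then have "int p dvd 1"
    by (cases "even (card X)") auto
  then show False using prime_gt_1_nat[OF p] by simp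
qed

section \<open>Coordinates of elementary abelian groups\<close>

text \<open>For a subgroup \<open>H\<close>, the maps \<open>\<phi> i\<close> taken modulo
  \<open>p\<close> form an injective homomorphism into the \<open>d\<close>-th power of the integers
  modulo \<open>p\<close>; the cardinality makes it an isomorphism. Integer values let the
  coordinates enter the integer polynomials directly.\<close>

definition has_coordinates ::
    "('a, 'b) monoid_scheme \<Rightarrow> nat \<Rightarrow> 'a set \<Rightarrow> nat \<Rightarrow> (nat \<Rightarrow> 'a \<Rightarrow> int) \<Rightarrow> bool" where
  "has_coordinates G p H d \<phi> \<longleftrightarrow> card H = p ^ d \<and>
     (\<forall>i<d. \<forall>x\<in>H. \<forall>y\<in>H. [\<phi> i (x \<otimes>\<^bsub>G\<^esub> y) = \<phi> i x + \<phi> i y] (mod int p)) \<and>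
     (\<forall>x\<in>H. (\<forall>i<d. int p dvd \<phi> i x) \<longrightarrow> x = \<one>\<^bsub>G\<^esub>)"

lemma (in monoid) pow_mod_if_pow_eq_one:
  assumes "x \<in> carrier G" "x [^] p = \<one>"
  shows "x [^] (r mod p) = x [^] (r::nat)"
proof -
  have "x [^] r = x [^] (p * (r div p) + r mod p)" by simp
  also have "\<dots> = (x [^] p) [^] (r div p) \<otimes> x [^] (r mod p)"
    unfolding nat_pow_pow[OF assms(1)] nat_pow_mult[OF assms(1)] ..
  finally show ?thesis using assms by simp
qed

text \<open>If \<open>m\<close> inverts \<open>e\<close> modulo \<open>p\<close>, then
  \<open>x\<close> is the \<open>m\<close>-th power of \<open>x [^] e\<close>.\<close>

lemma (in group) mem_subgroup_if_coprime_pow_mem: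
  assumes "subgroup H G" "x \<in> carrier G" "x [^] p = \<one>" "coprime e p" "x [^] (e::nat) \<in> H"
  shows "x \<in> H"
proof -
  obtain m where m: "[e * m = Suc 0] (mod p)" using cong_solve_coprime_nat[OF assms(4)] by blast
  have "x = x [^] (1::nat)" using assms(2) by simp
  also have "\<dots> = x [^] (e * m)" using m pow_mod_if_pow_eq_one[OF assms(2,3)] by (metis One_nat_def cong_def)
  also have "\<dots> = (x [^] e) [^] m" using assms(2) by (simp add: nat_pow_pow)
  also have "\<dots> \<in> H"
    using assms(1,5) by (induction m) (auto simp: subgroup.one_closed subgroup.m_closed)
  finally show ?thesis .
qed

text \<open>The larger subgroup is generated by \<open>H\<close> and \<open>x\<close>. Its elements
  are uniquely \<open>h \<otimes> x [^] c\<close> with \<open>c < p\<close>, and the exponent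
  \<open>c\<close> serves as the new coordinate.\<close>

lemma (in comm_group) has_coordinates_extend:
  assumes p: "prime p" and H: "subgroup H G" "has_coordinates G p H d \<phi>"
    and x: "x \<in> carrier G" "x \<notin> H" "x [^] p = \<one>"
  shows "\<exists>H' \<phi>'. subgroup H' G \<and> has_coordinates G p H' (Suc d) \<phi>' \<and> H \<subset> H'"
proof -
  interpret H: subgroup H G by fact
  define e where "e = (\<lambda>(h, c::nat). h \<otimes> x [^] c)"
  define H' where "H' = e ` (H \<times> {..<p})"
  have p0: "p > 0" "p > 1" using prime_gt_1_nat[OF p] by auto
  note red = pow_mod_if_pow_eq_one[OF x(1,3)]
  have mem: "h \<otimes> x [^] c \<in> H'" if "h \<in> H" for h and c :: nat
  proof -
    have "e (h, c mod p) \<in> H'" using that p0 by (auto simp: H'_def)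
    then show ?thesis by (simp add: e_def red)
  qed
  \<comment> \<open>Uniqueness of the exponent: otherwise a power of \<open>x\<close> with exponent
    coprime to \<open>p\<close> lies in \<open>H\<close>, and hence so does
    \<open>x\<close>.\<close>
  have aux: False if "h \<in> H" "h' \<in> H" "c < c'" "c' < p" "h \<otimes> x [^] c = h' \<otimes> x [^] c'" for h h' c c'
  proof -
    have "x [^] c' = x [^] (c' - c) \<otimes> x [^] c"
      using that by (simp add: nat_pow_mult x)
    then have "h = h' \<otimes> x [^] (c' - c)"
      using that x by (metis H.mem_carrier m_assoc m_closed nat_pow_closed right_cancel)
    then have "x [^] (c' - c) = inv h' \<otimes> h"
      using that x by (simp add: m_assoc[symmetric])
    then have "x [^] (c' - c) \<in> H" using that by simp
    moreover have "coprime (c' - c) p"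
      using that p by (metis coprime_commute dvd_imp_le less_imp_diff_less
          linorder_not_less prime_imp_coprime_nat zero_less_diff)
    ultimately show False
      using mem_subgroup_if_coprime_pow_mem[OF H(1) x(1,3)] x(2) by blast
  qed
  have inj: "inj_on e (H \<times> {..<p})"
  proof (rule inj_onI)
    fix u v assume "u \<in> H \<times> {..<p}" "v \<in> H \<times> {..<p}" "e u = e v"
    moreover obtain h c h' c' where uv: "u = (h, c)" "v = (h', c')" by fastforce
    ultimately have *: "h \<in> H" "c \<in> {..<p}" "h' \<in> H" "c' \<in> {..<p}" "e (h, c) = e (h', c')"
      by auto
    then have eq: "h \<otimes> x [^] c = h' \<otimes> x [^] c'" by (simp add: e_def)
    have c: "c = c'"
      using aux[of h h' c c'] aux[of h' h c' c] * eq by (metis lessThan_iff linorder_neqE_nat)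
    then show "u = v" using eq * x uv by simp
  qed
  define r where "r = inv_into (H \<times> {..<p}) e"
  have r: "r (h \<otimes> x [^] c) = (h, c mod p)" if "h \<in> H" for h and c :: nat
    using inv_into_f_f[OF inj, of "(h, c mod p)"] that p0 by (simp add: r_def e_def red)
  have H'D: "\<exists>h\<in>H. \<exists>c::nat. y = h \<otimes> x [^] c" if "y \<in> H'" for y
    using that by (auto simp: H'_def e_def)
  have mult: "(h \<otimes> x [^] c) \<otimes> (h' \<otimes> x [^] c') = (h \<otimes> h') \<otimes> x [^] (c + c')"
    if "h \<in> H" "h' \<in> H" for h h' and c c' :: nat
    using that x by (simp add: nat_pow_mult[symmetric] m_ac)
  have sub: "subgroup H' G"
  proof (rule subgroupI)
    show "H' \<subseteq> carrier G" using H'D x by fastforce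
    show "H' \<noteq> {}" using mem[OF H.one_closed] by blast
  next
    fix y assume "y \<in> H'"
    then obtain h c where y: "h \<in> H" "y = h \<otimes> x [^] (c::nat)" using H'D by blast
    \<comment> \<open>The exponent \<open>(p - 1) * c\<close> stands for \<open>-c\<close>, so that
      exponents remain natural numbers.\<close>
    have "(h \<otimes> x [^] c) \<otimes> (inv h \<otimes> x [^] ((p - 1) * c)) = \<one> \<otimes> x [^] (c + (p - 1) * c)"
      using y by (subst mult) auto
    also have "c + (p - 1) * c = p * c" using p0 by (metis add.commute add_mult_distrib le_add_diff_inverse2 less_imp_le mult_1)
    also have "x [^] (p * c) = \<one>" using x by (simp add: nat_pow_pow[symmetric])
    finally have "inv y = inv h \<otimes> x [^] ((p - 1) * c)"
      using y x by (intro inv_unique'[symmetric]) (auto simp: m_comm)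
    then show "inv y \<in> H'" using mem y by simp
  next
    fix y z assume "y \<in> H'" "z \<in> H'"
    then show "y \<otimes> z \<in> H'" using H'D mult mem by (metis H.m_closed)
  qed
  have card: "card H' = p ^ Suc d"
    using H(2) card_image[OF inj] by (simp add: H'_def has_coordinates_def card_cartesian_product)
  define \<phi>' where "\<phi>' i y = (if i < d then \<phi> i (fst (r y)) else int (snd (r y)))" for i y
  have "[\<phi>' i (y \<otimes> z) = \<phi>' i y + \<phi>' i z] (mod int p)" if yz: "y \<in> H'" "z \<in> H'" for i y z
  proof -
    obtain h c h' c' where *: "h \<in> H" "h' \<in> H" "y = h \<otimes> x [^] (c::nat)" "z = h' \<otimes> x [^] (c'::nat)"
      using H'D yz by meson
    show ?thesis
    proof (cases "i < d")
      case True
      then show ?thesis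
        using H(2) * unfolding has_coordinates_def by (simp add: \<phi>'_def mult r)
    next
      case False
      then show ?thesis
        using * by (simp add: \<phi>'_def mult r zmod_int cong_def mod_add_eq)
    qed
  qed
  moreover have "y = \<one>" if y: "y \<in> H'" "\<forall>i<Suc d. int p dvd \<phi>' i y" for y
  proof -
    obtain h c where *: "h \<in> H" "c < p" "y = h \<otimes> x [^] c"
      using y(1) by (auto simp: H'_def e_def)
    have "int p dvd \<phi> i h" if "i < d" for i
      using y(2)[rule_format, of i] that * r[of h c] by (simp add: \<phi>'_def)
    then have "h = \<one>" using H(2) * by (auto simp: has_coordinates_def)
    moreover have "int p dvd int c"
      using y(2)[rule_format, of d] * r[of h c] by (simp add: \<phi>'_def)
    then have "c = 0" using *(2) by (auto dest: dvd_imp_le)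
    ultimately show ?thesis using * by simp
  qed
  ultimately have "has_coordinates G p H' (Suc d) \<phi>'"
    using card by (simp add: has_coordinates_def)
  moreover have "H \<subset> H'"
  proof -
    have "h \<in> H'" if "h \<in> H" for h using mem[OF that, of 0] that by simp
    moreover have "x \<in> H'" using mem[OF H.one_closed, of 1] x by simp
    ultimately show ?thesis using x(2) by blast
  qed
  ultimately show ?thesis using sub by blast
qed

text \<open>A maximal subgroup with coordinates exists because the group is finite and the trivial
  subgroup has coordinates with \<open>d = 0\<close>. By the extension step it is the whole
  group.\<close>

lemma (in comm_group) has_coordinates_carrier:
  assumes p: "prime p" and fin: "finite (carrier G)"
    and exp: "\<And>x. x \<in> carrier G \<Longrightarrow> x [^] p = \<one>"
  shows "\<exists>d \<phi>. has_coordinates G p (carrier G) d \<phi>"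
proof -
  define P where "P H \<longleftrightarrow> subgroup H G \<and> (\<exists>d \<phi>. has_coordinates G p H d \<phi>)" for H
  have "has_coordinates G p {\<one>} 0 (\<lambda>_ _. 0)" by (simp add: has_coordinates_def)
  then have "P {\<one>}" using triv_subgroup unfolding P_def by blast
  moreover have "{H. P H} \<subseteq> Pow (carrier G)" by (auto simp: P_def dest: subgroup.subset)
  then have "finite {H. P H}" using fin finite_subset by blast
  ultimately obtain H where H: "P H" "\<And>K. P K \<Longrightarrow> H \<subseteq> K \<Longrightarrow> H = K"
    using finite_has_maximal[of "{H. P H}"] by auto
  then obtain d \<phi> where d: "subgroup H G" "has_coordinates G p H d \<phi>" by (auto simp: P_def)
  have "H = carrier G"
  proof (rule ccontr)
    assume "H \<noteq> carrier G"
    then obtain x where "x \<in> carrier G" "x \<notin> H" using subgroup.subset[OF d(1)] by blast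
    from has_coordinates_extend[OF p d this exp] this obtain H' where "P H'" "H \<subset> H'"
      unfolding P_def by blast
    then show False using H(2) by blast
  qed
  then show ?thesis using d by blast
qed

section \<open>Maps that are additive modulo an integer\<close>

lemma (in comm_group) cong_hom_inv:
  fixes \<psi> :: "'a \<Rightarrow> int"
  assumes hom: "\<And>x y. x \<in> carrier G \<Longrightarrow> y \<in> carrier G \<Longrightarrow> [\<psi> (x \<otimes> y) = \<psi> x + \<psi> y] (mod m)"
    and x: "x \<in> carrier G"
  shows "[\<psi> \<one> = 0] (mod m)" "[\<psi> (inv x) = - \<psi> x] (mod m)"
proof -
  show one: "[\<psi> \<one> = 0] (mod m)"
    using hom[of \<one> \<one>] by (simp add: cong_iff_dvd_diff)
  have "m dvd \<psi> \<one> - (\<psi> x + \<psi> (inv x))" using hom[of x "inv x"] x by (simp add: cong_iff_dvd_diff)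
  then have "m dvd \<psi> \<one> - (\<psi> \<one> - (\<psi> x + \<psi> (inv x)))"
    using one by (metis cong_iff_dvd_diff diff_zero dvd_diff)
  then show "[\<psi> (inv x) = - \<psi> x] (mod m)"
    by (simp add: cong_iff_dvd_diff add.commute)
qed

lemma (in comm_group) cong_hom_finprod:
  fixes \<psi> :: "'a \<Rightarrow> int"
  assumes hom: "\<And>x y. x \<in> carrier G \<Longrightarrow> y \<in> carrier G \<Longrightarrow> [\<psi> (x \<otimes> y) = \<psi> x + \<psi> y] (mod m)"
    and K: "finite K" "g \<in> K \<rightarrow> carrier G"
  shows "[\<psi> (finprod G g K) = (\<Sum>x\<in>K. \<psi> (g x))] (mod m)"
  using K
proof (induction K)
  case empty
  then show ?case using cong_hom_inv(1)[OF hom one_closed] by simp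
next
  case (insert x K)
  then have "[\<psi> (g x \<otimes> finprod G g K) = \<psi> (g x) + \<psi> (finprod G g K)] (mod m)"
    by (intro hom) auto
  also have "[\<psi> (g x) + \<psi> (finprod G g K) = \<psi> (g x) + (\<Sum>x\<in>K. \<psi> (g x))] (mod m)"
    using insert by (intro cong_add) auto
  finally show ?case using insert by (auto simp: Pi_iff)
qed

lemma (in comm_group) has_coordinates_inj:
  assumes "has_coordinates G p (carrier G) d \<phi>" "x \<in> carrier G" "y \<in> carrier G"
    and eq: "\<And>i. i < d \<Longrightarrow> [\<phi> i x = \<phi> i y] (mod int p)"
  shows "x = y"
proof -
  have "int p dvd \<phi> i (x \<otimes> inv y)" if i: "i < d" for i
  proof -
    have hom: "\<And>x y. x \<in> carrier G \<Longrightarrow> y \<in> carrier G \<Longrightarrow> [\<phi> i (x \<otimes> y) = \<phi> i x + \<phi> i y] (mod int p)"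
      using assms(1) i by (auto simp: has_coordinates_def)
    have "[\<phi> i (x \<otimes> inv y) = \<phi> i x + \<phi> i (inv y)] (mod int p)" using hom assms by simp
    also have "[\<phi> i x + \<phi> i (inv y) = \<phi> i y + - \<phi> i y] (mod int p)"
      by (intro cong_add eq i cong_hom_inv(2)[OF hom assms(3)])
    finally show ?thesis by (simp add: cong_0_iff)
  qed
  then have "x \<otimes> inv y = \<one>" using assms by (auto simp: has_coordinates_def)
  then show ?thesis using assms by (metis inv_closed inv_equality inv_inv)
qed

section \<open>Substitution and elimination of constants\<close>

primrec subst_term :: "(nat \<Rightarrow> 'f uterm) \<Rightarrow> 'f uterm \<Rightarrow> 'f uterm" where
  "subst_term \<sigma> (Var i) = \<sigma> i"
| "subst_term \<sigma> (App g ts) = App g (map (subst_term \<sigma>) ts)"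

lemma term_eval_subst_term:
  assumes "is_term A m t"
  shows "term_eval A xs (subst_term \<sigma> t) = term_eval A (map (\<lambda>i. term_eval A xs (\<sigma> i)) [0..<m]) t"
  using assms by (induction t) (auto simp: o_def cong: map_cong)

lemma is_term_subst_term:
  assumes "is_term A m t" "\<And>i. i < m \<Longrightarrow> is_term A n (\<sigma> i)"
  shows "is_term A n (subst_term \<sigma> t)"
  using assms by (induction t) auto

fun constants_to_variables :: "('a \<Rightarrow> nat) \<Rightarrow> ('f + 'a) uterm \<Rightarrow> 'f uterm" where
  "constants_to_variables v (Var i) = Var i"
| "constants_to_variables v (App (Inl g) ts) = App g (map (constants_to_variables v) ts)"
| "constants_to_variables v (App (Inr c) ts) = Var (v c)"

lemma constants_to_variables:
  assumes "is_term (const_expansion A) n t" "length xs = n"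
    and v: "\<And>c. c \<in> carrier A \<Longrightarrow> v c < length cs \<and> cs ! v c = c"
  shows "is_term A (n + length cs) (constants_to_variables (\<lambda>c. n + v c) t) \<and>
    term_eval A (xs @ cs) (constants_to_variables (\<lambda>c. n + v c) t) = term_eval (const_expansion A) xs t"
  using assms(1)
proof (induction t)
  case (Var i)
  then show ?case using assms(2) by (simp add: nth_append)
next
  case (App g ts)
  show ?case
  proof (cases g)
    case (Inl g')
    with App have "\<forall>t\<in>set ts. is_term (const_expansion A) n t" "g' \<in> fsyms A" "length ts = arity A g'"
      by (auto simp: const_expansion_def)
    then show ?thesis using App.IH Inl
      by (auto simp: const_expansion_def o_def intro!: arg_cong[of _ _ "interp A g'"])
  next
    case (Inr c)
    then show ?thesis using App.prems assms(2) v[of c] by (auto simp: const_expansion_def nth_append)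
  qed
qed

text \<open>The term condition concerns term functions only. Constants therefore become extra
  variables, to which the elements of the finite carrier, listed in \<open>cs\<close>, are
  assigned.\<close>

lemma Pol_imp_term_with_parameters:
  assumes "finite (carrier A)"
  shows "\<exists>cs. set cs = carrier A \<and> (\<forall>n. \<forall>f\<in>Pol A n. \<exists>t. is_term A (n + length cs) t \<and>
    (\<forall>xs\<in>tuples (carrier A) n. f xs = term_eval A (xs @ cs) t))"
proof -
  obtain cs where cs: "set cs = carrier A" using finite_list assms by blast
  then have "\<forall>c\<in>carrier A. \<exists>i. i < length cs \<and> cs ! i = c" by (metis in_set_conv_nth)
  then obtain v where v: "\<And>c. c \<in> carrier A \<Longrightarrow> v c < length cs \<and> cs ! v c = c" by metis
  have "\<exists>t. is_term A (n + length cs) t \<and> (\<forall>xs\<in>tuples (carrier A) n. f xs = term_eval A (xs @ cs) t)"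
    if f: "f \<in> Pol A n" for n f
  proof -
    obtain t where t: "is_term (const_expansion A) n t"
        "f = (\<lambda>xs\<in>tuples (carrier A) n. term_eval (const_expansion A) xs t)"
      using f by (auto simp: Pol_def term_funs_def const_expansion_def)
    let ?t = "constants_to_variables (\<lambda>c. n + v c) t"
    have "is_term A (n + length cs) ?t"
      using constants_to_variables[OF t(1) _ v, of "replicate n undefined"] by simp
    moreover have "f xs = term_eval A (xs @ cs) ?t" if "xs \<in> tuples (carrier A) n" for xs
      using constants_to_variables[OF t(1) _ v, of xs] that t(2) by (simp add: tuples_def)
    ultimately show ?thesis by blast
  qed
  then show ?thesis using cs by blast
qed

section \<open>Alternating products and supernilpotence\<close>

text \<open>The alternating sum of \<open>(- 1) ^ card J * g J\<close> over
  \<open>J \<subseteq> I\<close>, in multiplicative notation.\<close>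

definition alternating_prod :: "('a, 'b) monoid_scheme \<Rightarrow> 'c set \<Rightarrow> ('c set \<Rightarrow> 'a) \<Rightarrow> 'a" where
  "alternating_prod G I g =
     finprod G (\<lambda>J. if even (card J) then g J else inv\<^bsub>G\<^esub> (g J)) (Pow I)"

text \<open>The factors for \<open>J\<close> and \<open>insert u J\<close> are mutually
  inverse.\<close>

lemma (in comm_group) alternating_prod_eq_one:
  assumes "finite I" "u \<in> I" "g \<in> Pow I \<rightarrow> carrier G"
    and eq: "\<And>J. J \<subseteq> I \<Longrightarrow> g (insert u J) = g J"
  shows "alternating_prod G I g = \<one>"
proof -
  define V where "V = I - {u}"
  have V: "I = insert u V" "u \<notin> V" "finite V" using assms by (auto simp: V_def)
  define w where "w J = (if even (card J) then g J else inv (g J))" for J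
  have w: "w \<in> Pow I \<rightarrow> carrier G" using assms(3) by (auto simp: w_def Pi_iff)
  have inj: "inj_on (insert u) (Pow V)" using V(2) by (intro inj_onI) (metis PowD insert_ident subsetD)
  have "finprod G w (Pow I) = finprod G w (Pow V) \<otimes> finprod G w (insert u ` Pow V)"
    unfolding V(1) Pow_insert using V w by (intro finprod_Un_disjoint) (auto simp: Pi_iff)
  also have "finprod G w (insert u ` Pow V) = finprod G (\<lambda>J. w (insert u J)) (Pow V)"
    using V w by (intro finprod_reindex inj) (auto simp: Pi_iff)
  also have "finprod G w (Pow V) \<otimes> \<dots> = finprod G (\<lambda>J. w J \<otimes> w (insert u J)) (Pow V)"
    using V w by (intro finprod_multf[symmetric]) (auto simp: Pi_iff)
  also have "\<dots> = \<one>"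
  proof (rule finprod_one_eqI)
    fix J assume J: "J \<in> Pow V"
    then have "finite J" "u \<notin> J" "g J \<in> carrier G" "g (insert u J) = g J"
      using V finite_subset assms(3) eq[of J] by (auto simp: Pi_iff)
    then show "w J \<otimes> w (insert u J) = \<one>" by (auto simp: w_def)
  qed
  finally show ?thesis by (simp add: alternating_prod_def w_def[abs_def])
qed

lemma expanded_group_simps:
  "carrier (expanded_group G S ar f) = carrier G"
  "Plus \<in> fsyms (expanded_group G S ar f)"
  "Minus \<in> fsyms (expanded_group G S ar f)"
  "Zero \<in> fsyms (expanded_group G S ar f)"
  "arity (expanded_group G S ar f) Plus = 2"
  "arity (expanded_group G S ar f) Minus = 1"
  "arity (expanded_group G S ar f) Zero = 0"
  "interp (expanded_group G S ar f) Plus xs = xs ! 0 \<otimes>\<^bsub>G\<^esub> xs ! 1"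
  "interp (expanded_group G S ar f) Minus xs = inv\<^bsub>G\<^esub> (xs ! 0)"
  "interp (expanded_group G S ar f) Zero xs = \<one>\<^bsub>G\<^esub>"
  by (simp_all add: expanded_group_def)

lemma (in comm_group) finprod_term:
  assumes A: "A = expanded_group G S ar f" "is_ualg A"
    and "finite K" "\<And>J. J \<in> K \<Longrightarrow> is_term A m (T J)"
  shows "\<exists>t. is_term A m t \<and>
    (\<forall>xs\<in>tuples (carrier G) m. term_eval A xs t = finprod G (\<lambda>J. term_eval A xs (T J)) K)"
  using assms(3,4)
proof (induction K)
  case empty
  show ?case by (rule exI[of _ "App Zero []"]) (simp add: A(1) expanded_group_simps)
next
  case (insert J K)
  then obtain t where t: "is_term A m t"
      "\<forall>xs\<in>tuples (carrier G) m. term_eval A xs t = finprod G (\<lambda>J. term_eval A xs (T J)) K"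
    by auto
  have "term_eval A xs (T L) \<in> carrier G" if "L \<in> insert J K" "xs \<in> tuples (carrier G) m" for L xs
    using term_eval_closed[OF A(2)] that insert.prems A(1) by (simp add: expanded_group_simps)
  then show ?case using insert t
    by (intro exI[of _ "App Plus [T J, t]"]) (auto simp: A(1) expanded_group_simps Pi_iff)
qed

text \<open>The group operations are basic operations of the algebra, so the whole alternating
  product is a single term, to which the term condition can be applied.\<close>

lemma (in comm_group) alternating_prod_term:
  assumes A: "A = expanded_group G S ar f" "is_ualg A"
    and "finite I" "\<And>J. J \<subseteq> I \<Longrightarrow> is_term A m (T J)"
  shows "\<exists>t. is_term A m t \<and>
    (\<forall>xs\<in>tuples (carrier G) m. term_eval A xs t = alternating_prod G I (\<lambda>J. term_eval A xs (T J)))"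
proof -
  define T' where "T' J = (if even (card J) then T J else App Minus [T J])" for J
  have eq: "term_eval A xs (T' J) =
      (if even (card J) then term_eval A xs (T J) else inv (term_eval A xs (T J)))" for J xs
    by (simp add: T'_def A(1) expanded_group_simps)
  have "is_term A m (T' J)" if "J \<in> Pow I" for J
    using assms(4)[of J] that by (auto simp: T'_def A(1) expanded_group_simps)
  with finprod_term[OF A, of "Pow I" m T'] show ?thesis
    using assms(3) by (simp add: eq alternating_prod_def)
qed

lemma length_restrict_tuple [simp]: "length (restrict_tuple G a U) = length a"
  by (simp add: restrict_tuple_def del: upt_Suc)

lemma nth_restrict_tuple [simp]:
  "i < length a \<Longrightarrow> restrict_tuple G a U ! i = (if Suc i \<in> U then a ! i else \<one>\<^bsub>G\<^esub>)"
  by (simp add: restrict_tuple_def del: upt_Suc)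

lemma (in monoid) restrict_tuple_closed:
  "a \<in> tuples (carrier G) n \<Longrightarrow> restrict_tuple G a U \<in> tuples (carrier G) n"
  by (auto simp: tuples_def restrict_tuple_def in_set_conv_nth subset_iff simp del: upt_Suc)

lemma restrict_tuple_all: "restrict_tuple G a {1..length a} = a"
  by (rule nth_equalityI) auto

text \<open>
  The singletons \<open>{b}\<close>, \<open>b \<in> B\<close>, and the remainder \<open>I - B\<close> form \<open>k + 1\<close> nonempty blocks of
  coordinates. Switching a block off makes the alternating product trivial, so the term condition
  makes it trivial as well when all blocks are on.
\<close>

lemma (in comm_group) alternating_prod_supernilpotent:
  fixes A :: "('a, 'i gsym) ualg"
  assumes A: "A = expanded_group G S ar f" "is_ualg A" and fin: "finite (carrier G)"
    and sn: "supernilpotent k A" and F: "F \<in> Pol A n" and a: "a \<in> tuples (carrier G) n"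
    and I: "I \<subseteq> {1..n}" "k < card I"
  shows "alternating_prod G I (\<lambda>J. F (restrict_tuple G a J)) = \<one>"
proof -
  have interp_Zero: "interp A Zero xs = \<one>" for xs by (simp add: A(1) expanded_group_simps)
  have carA: "carrier A = carrier G" by (simp add: A(1) expanded_group_simps)
  have la: "length a = n" using a by (simp add: tuples_def)
  have finI: "finite I" using I finite_subset by blast
  obtain cs t where cs: "set cs = carrier G" and t: "is_term A (n + length cs) t"
      "\<And>xs. xs \<in> tuples (carrier G) n \<Longrightarrow> F xs = term_eval A (xs @ cs) t"
    using Pol_imp_term_with_parameters[of A] fin F carA by metis
  obtain B where B: "B \<subseteq> I" "card B = k" "finite B"
    using obtain_subset_with_card_n[of k I] I by auto
  obtain e where e: "bij_betw e {..<k} B"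
    using ex_bij_betw_nat_finite[OF B(3)] B(2) by (auto simp: atLeast0LessThan)
  define ix where "ix = inv_into {..<k} e"
  have ix: "ix b < k" "e (ix b) = b" if "b \<in> B" for b
    using that bij_betw_inv_into[OF e] bij_betw_inv_into_right[OF e]
    by (auto simp: ix_def bij_betw_def)
  have e_in: "e j \<in> B" if "j < k" for j using e that by (auto simp: bij_betw_def)
  \<comment> \<open>Layout of the variables: \<open>k\<close> for the singleton blocks,
    \<open>n\<close> for the coordinates, then the parameters. The substitution
    \<open>\<sigma> J\<close> puts zero for coordinates outside \<open>J\<close> and reads those in
    \<open>J \<inter> B\<close> from their block variable. Thus position \<open>k + v\<close> is
    never read when \<open>v < n\<close> and \<open>Suc v \<in> B\<close>.\<close>
  define N where "N = k + n + length cs"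
  define \<sigma> :: "nat set \<Rightarrow> nat \<Rightarrow> 'i gsym uterm" where "\<sigma> J v = (if v < n then
      if Suc v \<in> J then if Suc v \<in> B then Var (ix (Suc v)) else Var (k + v) else App Zero []
      else Var (k + v))" for J v
  define T where "T J = subst_term (\<sigma> J) t" for J
  have T: "is_term A N (T J)" for J
    unfolding T_def
    by (rule is_term_subst_term[OF t(1)])
      (use ix in \<open>auto simp: \<sigma>_def A(1) expanded_group_simps N_def intro: trans_less_add1\<close>)
  obtain h where h: "is_term A N h" "\<And>xs. xs \<in> tuples (carrier G) N \<Longrightarrow>
      term_eval A xs h = alternating_prod G I (\<lambda>J. term_eval A xs (T J))"
    using alternating_prod_term[OF A finI, of N T] T by blast
  define as where "as = replicate k [\<one>]"
  define bs where "bs = map (\<lambda>j. [a ! (e j - 1)]) [0..<k]"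
  \<comment> \<open>\<open>a0\<close> and \<open>b0\<close> switch the remainder block off and on.
    The parameters \<open>cs\<close> stay the same in both, and the entries of \<open>b0\<close> at
    coordinates in \<open>B\<close> are never read.\<close>
  define a0 where "a0 = replicate n \<one> @ cs"
  define b0 where "b0 = a @ cs"
  define sel where "sel K = map (\<lambda>j. if j \<in> K then a ! (e j - 1) else \<one>) [0..<k]" for K
  have sel: "concat (select_tuples K as bs) = sel K" for K
  proof -
    have "select_tuples K as bs = map (\<lambda>j. [if j \<in> K then a ! (e j - 1) else \<one>]) [0..<k]"
      by (rule nth_equalityI) (auto simp: select_tuples_def as_def bs_def)
    then show ?thesis by (simp add: sel_def concat_map_singleton)
  qed
  have bs: "concat bs = sel {..<k}"
    unfolding bs_def sel_def by (simp add: concat_map_singleton)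
  have a_in: "a ! i \<in> carrier G" if "i < n" for i
    using a that nth_mem[of i a] by (auto simp: tuples_def)
  have a_e: "a ! (e j - 1) \<in> carrier G" if "j < k" for j
  proof -
    have "e j \<in> {1..n}" using e_in[OF that] B(1) I(1) by blast
    then show ?thesis by (intro a_in) auto
  qed
  \<comment> \<open>Here \<open>M\<close> collects the coordinates that are switched on, by
    \<open>K\<close> inside \<open>B\<close> and by \<open>z\<close> outside
    \<open>B\<close>.\<close>
  have val: "term_eval A (sel K @ z @ cs) h = alternating_prod G I (\<lambda>J. F (restrict_tuple G a (J \<inter> M)))"
    if z: "z \<in> tuples (carrier G) n"
        "\<And>v. v < n \<Longrightarrow> Suc v \<notin> B \<Longrightarrow> z ! v = (if Suc v \<in> M then a ! v else \<one>)"
      and M: "\<And>b. b \<in> B \<Longrightarrow> b \<in> M \<longleftrightarrow> ix b \<in> K" for K z M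
  proof -
    have len: "length (sel K) = k" "length z = n" using z(1) by (simp_all add: sel_def tuples_def)
    have "sel K @ z @ cs \<in> tuples (carrier G) N"
      using z(1) a_e cs by (auto simp: tuples_def N_def sel_def)
    then have "term_eval A (sel K @ z @ cs) h =
        alternating_prod G I (\<lambda>J. term_eval A (sel K @ z @ cs) (T J))"
      by (rule h(2))
    also have "(\<lambda>J. term_eval A (sel K @ z @ cs) (T J)) = (\<lambda>J. F (restrict_tuple G a (J \<inter> M)))"
    proof
      fix J
      have "map (\<lambda>v. term_eval A (sel K @ z @ cs) (\<sigma> J v)) [0..<n + length cs] =
          restrict_tuple G a (J \<inter> M) @ cs" (is "?l = ?r")
      proof (rule nth_equalityI)
        show "length ?l = length ?r" by (simp add: la)
      next
        fix v assume "v < length ?l"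
        then have v: "v < n + length cs" by simp
        have block: "(sel K @ z @ cs) ! ix b = (if ix b \<in> K then a ! (b - 1) else \<one>)" if "b \<in> B" for b
          using ix[OF that] by (simp add: nth_append len) (simp add: sel_def)
        have rest: "(sel K @ z @ cs) ! (k + v) = (if v < n then z ! v else cs ! (v - n))"
          using len by (simp add: nth_append)
        have "?r ! v = (if v < n then if Suc v \<in> J \<and> Suc v \<in> M then a ! v else \<one> else cs ! (v - n))"
          using la by (simp add: nth_append)
        also have "\<dots> = term_eval A (sel K @ z @ cs) (\<sigma> J v)"
          using z(2)[of v] M[of "Suc v"] block[of "Suc v"]
          by (simp add: \<sigma>_def rest interp_Zero)
        finally show "?l ! v = ?r ! v" using v by simp
      qed
      then show "term_eval A (sel K @ z @ cs) (T J) = F (restrict_tuple G a (J \<inter> M))"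
        using term_eval_subst_term[OF t(1)] t(2)[OF restrict_tuple_closed[OF a]] by (simp add: T_def)
    qed
    finally show ?thesis .
  qed
  define M where "M K = e ` (K \<inter> {..<k})" for K
  have M: "b \<in> M K \<longleftrightarrow> ix b \<in> K" if "b \<in> B" for b K
    using ix[OF that] that bij_betw_inv_into_left[OF e] by (force simp: ix_def M_def)
  have M_sub: "M K \<subseteq> B" for K using e_in by (auto simp: M_def)
  have zeros: "term_eval A (sel K @ a0) h = alternating_prod G I (\<lambda>J. F (restrict_tuple G a (J \<inter> M K)))" for K
    unfolding a0_def using M M_sub by (intro val) (auto simp: tuples_def)
  have ones: "term_eval A (sel K @ b0) h =
      alternating_prod G I (\<lambda>J. F (restrict_tuple G a (J \<inter> (M K \<union> ({1..n} - B)))))" for K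
    unfolding b0_def using M M_sub a by (intro val) auto
  \<comment> \<open>A coordinate \<open>u\<close> that is switched off does not affect
    \<open>J \<inter> M'\<close>, so the factors cancel in pairs.\<close>
  have one: "alternating_prod G I (\<lambda>J. F (restrict_tuple G a (J \<inter> M'))) = \<one>"
    if "u \<in> I" "u \<notin> M'" for u M'
  proof (rule alternating_prod_eq_one[OF finI that(1)])
    have "F xs \<in> carrier G" if "xs \<in> tuples (carrier G) n" for xs
      using t(2)[OF that] that cs term_eval_closed[OF A(2) _ t(1)] by (simp add: carA tuples_def)
    then show "(\<lambda>J. F (restrict_tuple G a (J \<inter> M'))) \<in> Pow I \<rightarrow> carrier G"
      using restrict_tuple_closed[OF a] by blast
  qed (use that in simp)
  define tt where "tt = (\<lambda>xs\<in>tuples (carrier A) N. term_eval A xs h)"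
  have tt: "tt (sel K @ z) = term_eval A (sel K @ z) h" if "z = a0 \<or> z = b0" for K z
    using that a a_e cs by (auto simp: tt_def tuples_def N_def sel_def a0_def b0_def carA)
  have "tt \<in> term_funs A (length (concat as) + length a0)"
  proof -
    have "length (concat as) + length a0 = N"
      by (simp add: as_def a0_def N_def length_concat sum_list_replicate)
    then show ?thesis using h(1) by (auto simp: term_funs_def tt_def)
  qed
  moreover have "\<forall>i<k. list_all2 (\<lambda>x y. (x, y) \<in> replicate k (carrier A \<times> carrier A) ! i) (as ! i) (bs ! i)"
    using a_e by (simp add: as_def bs_def carA)
  moreover have "list_all2 (\<lambda>x y. (x, y) \<in> carrier A \<times> carrier A) a0 b0"
    using a cs by (auto simp: a0_def b0_def carA list_all2_conv_all_nth nth_append tuples_def)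
  \<comment> \<open>Premise of the term condition: some singleton block is off, which makes both
    sides trivial.\<close>
  moreover have "(tt (concat (select_tuples K as bs) @ a0), tt (concat (select_tuples K as bs) @ b0)) \<in> Id_on (carrier A)"
    if K: "K \<subset> {..<k}" for K
  proof -
    obtain j where j: "j < k" "j \<notin> K" using K by auto
    have u: "e j \<in> I" "e j \<in> B" "e j \<notin> M K"
      using j e_in[of j] B M[of "e j" K] bij_betw_inv_into_left[OF e, of j] by (auto simp: ix_def)
    then have "tt (sel K @ a0) = \<one>" "tt (sel K @ b0) = \<one>"
      by (simp_all add: tt zeros ones one[OF u(1)])
    then show ?thesis by (simp add: sel carA Id_onI)
  qed
  moreover have "length as = k" "length bs = k" by (simp_all add: as_def bs_def)
  moreover have "centralizes A (replicate k (carrier A \<times> carrier A)) (carrier A \<times> carrier A) (Id_on (carrier A))"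
    using centralizes_commutator sn unfolding supernilpotent_def by metis
  ultimately have "(tt (concat bs @ a0), tt (concat bs @ b0)) \<in> Id_on (carrier A)"
    unfolding centralizes_def by (metis length_replicate)
  then have "tt (sel {..<k} @ a0) = tt (sel {..<k} @ b0)" by (auto simp: bs)
  \<comment> \<open>Only the remainder block is off; it meets \<open>I\<close> because
    \<open>card B = k < card I\<close>.\<close>
  moreover have "tt (sel {..<k} @ a0) = \<one>"
  proof -
    have "B \<noteq> I" using B I by auto
    then obtain u where "u \<in> I" "u \<notin> B" using B by blast
    then show ?thesis using one[of u "M {..<k}"] M_sub by (auto simp: tt zeros)
  qed
  moreover have "tt (sel {..<k} @ b0) = alternating_prod G I (\<lambda>J. F (restrict_tuple G a J))"
  proof -
    have "M {..<k} \<union> ({1..n} - B) = {1..n}"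
      using e B I by (auto simp: M_def bij_betw_def)
    then have "tt (sel {..<k} @ b0) = alternating_prod G I (\<lambda>J. F (restrict_tuple G a (J \<inter> {1..n})))"
      by (simp add: tt ones)
    moreover have "restrict_tuple G a (J \<inter> {1..n}) = restrict_tuple G a J" for J
      by (rule nth_equalityI) (auto simp: la)
    ultimately show ?thesis by simp
  qed
  ultimately show ?thesis by simp
qed

section \<open>Coordinates of polynomial functions\<close>

text \<open>By Lagrange, the common prime order of the nontrivial elements divides
  \<open>p ^ \<alpha>\<close> and hence equals \<open>p\<close>.\<close>

lemma (in comm_group) elementary_abelian_pow_eq_one:
  assumes "elementary_abelian_group G" "prime p" "order G = p ^ \<alpha>" "x \<in> carrier G"
  shows "x [^] p = \<one>"
proof (cases "x = \<one>")
  case False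
  obtain q :: nat where q: "prime q" "\<forall>x\<in>carrier G. x \<noteq> \<one> \<longrightarrow> ord x = q"
    using assms(1) by (auto simp: elementary_abelian_group_def)
  then have "ord x = q" using assms(4) False by blast
  then have "q dvd p ^ \<alpha>" using ord_dvd_group_order[OF assms(4)] assms(3) by simp
  then have "q = p" using q(1) assms(2) prime_dvd_power primes_dvd_imp_eq by blast
  then show ?thesis using pow_ord_eq_1[OF assms(4)] \<open>ord x = q\<close> by simp
qed simp

lemma (in comm_group) cong_hom_alternating_prod:
  fixes \<psi> :: "'a \<Rightarrow> int"
  assumes hom: "\<And>x y. x \<in> carrier G \<Longrightarrow> y \<in> carrier G \<Longrightarrow> [\<psi> (x \<otimes> y) = \<psi> x + \<psi> y] (mod m)"
    and I: "finite I" "g \<in> Pow I \<rightarrow> carrier G"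
  shows "[\<psi> (alternating_prod G I g) = (\<Sum>J\<in>Pow I. (- 1) ^ card J * \<psi> (g J))] (mod m)"
proof -
  have "[\<psi> (alternating_prod G I g) =
      (\<Sum>J\<in>Pow I. \<psi> (if even (card J) then g J else inv (g J)))] (mod m)"
    unfolding alternating_prod_def using I by (intro cong_hom_finprod[OF hom]) (auto simp: Pi_iff)
  also have "[(\<Sum>J\<in>Pow I. \<psi> (if even (card J) then g J else inv (g J))) =
      (\<Sum>J\<in>Pow I. (- 1) ^ card J * \<psi> (g J))] (mod m)"
  proof (rule cong_sum)
    fix J assume "J \<in> Pow I"
    then have "g J \<in> carrier G" using I by auto
    then show "[\<psi> (if even (card J) then g J else inv (g J)) = (- 1) ^ card J * \<psi> (g J)] (mod m)"
      using cong_hom_inv(2)[OF hom, of "g J"] by simp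
  qed
  finally show ?thesis .
qed

text \<open>Applying \<open>\<psi>\<close> to the trivial alternating products gives alternating
  sums divisible by \<open>m\<close>, as Moebius inversion requires.\<close>

lemma (in comm_group) bool_degree_coordinate:
  fixes \<psi> :: "'a \<Rightarrow> int"
  assumes A: "A = expanded_group G S ar f" "is_ualg A" and fin: "finite (carrier G)"
    and sn: "supernilpotent k A" and F: "F \<in> Pol A n" and a: "a \<in> tuples (carrier G) n"
    and hom: "\<And>x y. x \<in> carrier G \<Longrightarrow> y \<in> carrier G \<Longrightarrow> [\<psi> (x \<otimes> y) = \<psi> x + \<psi> y] (mod m)"
    and F_closed: "\<And>xs. xs \<in> tuples (carrier G) n \<Longrightarrow> F xs \<in> carrier G"
  shows "\<exists>h. bool_degree k h \<and> (\<forall>X\<subseteq>{1..n}. [h X = \<psi> (F (restrict_tuple G a X))] (mod m))"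
proof (rule bool_degree_cong_if_alternating_sums_dvd)
  fix I assume I: "I \<subseteq> {1..n}" "k < card I"
  let ?g = "\<lambda>J. F (restrict_tuple G a J)"
  have finI: "finite I" using I finite_subset by blast
  have g: "?g \<in> Pow I \<rightarrow> carrier G" using F_closed restrict_tuple_closed[OF a] by blast
  have "[(\<Sum>J\<in>Pow I. (- 1) ^ card J * \<psi> (?g J)) = \<psi> (alternating_prod G I ?g)] (mod m)"
    using cong_hom_alternating_prod[OF hom finI g] by (rule cong_sym)
  also have "alternating_prod G I ?g = \<one>"
    by (rule alternating_prod_supernilpotent[OF A fin sn F a I])
  also have "[\<psi> \<one> = 0] (mod m)" by (rule cong_hom_inv(1)[OF hom one_closed])
  finally show "m dvd (\<Sum>J\<in>Pow I. (- 1) ^ card J * \<psi> (?g J))" by (simp add: cong_0_iff)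
qed simp

section \<open>The degree bound for a minimal set of coordinates\<close>

theorem theorem4p2:
  fixes G :: "'a monoid" and S :: "'i set" and ar :: "'i \<Rightarrow> nat" and f :: "'i \<Rightarrow> 'a list \<Rightarrow> 'a"
    and A :: "('a, 'i gsym) ualg" and F :: "'a list \<Rightarrow> 'a list" and a :: "'a list"
    and k n s \<alpha> p :: nat
  assumes "prime p"
    and "expanded_elementary_abelian_group G S ar f"
    and "A = expanded_group G S ar f"
    and "supernilpotent k A"
    and "order G = p ^ \<alpha>"
    and "F \<in> Pol_vec A n s"
    and "a \<in> tuples (carrier G) n"
  shows "\<exists>U \<subseteq> {1..n}. card U \<le> k * s * \<alpha> * (p - 1) \<and> F a = F (restrict_tuple G a U)"
proof -
  have elem: "elementary_abelian_group G"
    using assms(2) by (simp add: expanded_elementary_abelian_group_def)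
  then interpret comm_group G by (simp add: elementary_abelian_group_def)
  have ualg: "is_ualg A" using is_ualg_expanded_group assms(2,3) by blast
  have carA: "carrier A = carrier G" by (simp add: assms(3) expanded_group_simps)
  have la: "length a = n" using assms(7) by (simp add: tuples_def)
  have fin: "finite (carrier G)"
    using assms(1,5) prime_gt_0_nat order_gt_0_iff_finite by (metis zero_less_power)
  obtain d \<phi> where \<phi>: "has_coordinates G p (carrier G) d \<phi>"
    using has_coordinates_carrier[OF assms(1) fin] elementary_abelian_pow_eq_one[OF elem assms(1,5)]
    by blast
  \<comment> \<open>Counting elements identifies the number of coordinates with
    \<open>\<alpha>\<close>.\<close>
  have "p ^ d = p ^ \<alpha>" using \<phi> assms(5) by (simp add: has_coordinates_def order_def)
  then have d: "d = \<alpha>" using prime_gt_1_nat[OF assms(1)] by simp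
  obtain fs where fs: "length fs = s" "set fs \<subseteq> Pol A n"
      "F = (\<lambda>xs\<in>tuples (carrier G) n. map (\<lambda>f. f xs) fs)"
    using assms(6) by (auto simp: Pol_vec_def tuples_def carA)
  note res = restrict_tuple_closed[OF assms(7)]
  have pol: "fs ! l \<in> Pol A n" if "l < s" for l using fs that by auto
  have closed: "g xs \<in> carrier G" if "g \<in> Pol A n" "xs \<in> tuples (carrier G) n" for g xs
  proof -
    have "is_ualg (const_expansion A)"
      using ualg by (auto simp: is_ualg_def const_expansion_def Pi_iff)
    then show ?thesis
      using term_fun_closed[of "const_expansion A" xs n g] that
      by (simp add: Pol_def const_expansion_def carA)
  qed
  have "\<exists>h. bool_degree k h \<and>
      (\<forall>X\<subseteq>{1..n}. [h X = \<phi> j ((fs ! l) (restrict_tuple G a X))] (mod int p))"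
    if "l < s" "j < d" for l j
    using \<phi> that(2) closed[OF pol[OF that(1)]]
    by (intro bool_degree_coordinate[OF assms(3) ualg fin assms(4) pol[OF that(1)] assms(7)])
      (auto simp: has_coordinates_def)
  then obtain h where h: "\<And>l j. l < s \<Longrightarrow> j < d \<Longrightarrow> bool_degree k (h l j)"
      "\<And>l j X. l < s \<Longrightarrow> j < d \<Longrightarrow> X \<subseteq> {1..n} \<Longrightarrow>
        [h l j X = \<phi> j ((fs ! l) (restrict_tuple G a X))] (mod int p)"
    by metis
  \<comment> \<open>For an inclusion-minimal \<open>X\<close> in this family, each proper subset
    gives a value of \<open>F\<close> other than \<open>F a\<close>. One of the \<open>s * d\<close>
    coordinates, indexed by pairs \<open>(l, j)\<close>, detects the difference modulo
    \<open>p\<close>.\<close>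
  define \<X> where "\<X> = {X. X \<subseteq> {1..n} \<and> F (restrict_tuple G a X) = F a}"
  have "{1..n} \<in> \<X>" using restrict_tuple_all[of G a] la by (simp add: \<X>_def)
  moreover have "finite \<X>" by (simp add: \<X>_def)
  ultimately obtain X where X: "X \<in> \<X>" and min: "\<And>Y. Y \<in> \<X> \<Longrightarrow> Y \<subseteq> X \<Longrightarrow> X = Y"
    using finite_has_minimal[of \<X>] by auto
  have Xn: "X \<subseteq> {1..n}" using X by (simp add: \<X>_def)
  have "card X \<le> k * card ({..<s} \<times> {..<d}) * (p - 1)"
  proof (rule card_le_if_bool_degree_separates[OF assms(1), where h = "\<lambda>(l, j). h l j"])
    show "finite X" using Xn finite_subset by blast
  next
    fix Y assume Y: "Y \<subset> X"
    then have "F (restrict_tuple G a Y) \<noteq> F (restrict_tuple G a X)"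
      using min[of Y] X Xn by (auto simp: \<X>_def)
    then obtain l where l: "l < s" "(fs ! l) (restrict_tuple G a Y) \<noteq> (fs ! l) (restrict_tuple G a X)"
      using res fs(1) by (auto simp: fs(3) in_set_conv_nth)
    then obtain j where j: "j < d" "\<not> [\<phi> j ((fs ! l) (restrict_tuple G a Y)) =
        \<phi> j ((fs ! l) (restrict_tuple G a X))] (mod int p)"
      using has_coordinates_inj[OF \<phi>] closed[OF pol[OF l(1)] res] by meson
    have "\<not> [h l j Y = h l j X] (mod int p)"
      using j(2) h(2)[OF l(1) j(1), of Y] h(2)[OF l(1) j(1), of X] Y Xn
      by (metis cong_sym cong_trans order_trans psubset_imp_subset)
    then show "\<exists>i\<in>{..<s} \<times> {..<d}. \<not> [(case i of (l, j) \<Rightarrow> h l j) Y = (case i of (l, j) \<Rightarrow> h l j) X] (mod int p)"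
      using l(1) j(1) by (intro bexI[of _ "(l, j)"]) auto
  qed (use h(1) in auto)
  then show ?thesis
    using X by (intro exI[of _ X]) (simp add: \<X>_def d card_cartesian_product mult_ac)
qed

end
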